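(* Let $N, K$ be integers with $1\le N < \left\lceil \frac{K+1}{2}\right\rceil$. Then every achievable memory-rate pair $(M,R)$ for the $(N,K)$ cache network (with cache size $M$ in the range $\left[\frac1K,\frac NK\right]$) satisfies $$\frac{K\left(N(K+3)-2(N^2+1)\right)}{2}\,M+\frac{K(K+3-2N)}{2}\,R\ \ge\ \frac{NK(K-2N+3)-2}{2}.$$
   Context: Notation: $[L]=\{1,\dots,L\}$. $(N,K)$ cache network (with $1\le N\le K$): a server holds $N$ independent files $W_1,\dots,W_N$, each of size $F$ bits (uniformly distributed); there are $K$ users connected to the server by a common error-free link, and user $k$ has a cache. For $A\subseteq[N]$, $W_A=(W_n)_{n\in A}$. All sizes and entropies $H$ are measured in units of $F$ bits, so $H(W_{[N]})=N$. Demands: $\boldsymbol{D}$ is the set of all surjective vectors $\boldsymbol{d}=(d_1,\dots,d_K)\in[N]^K$ (user $k$ requests file $W_{d_k}$, and every file is requested by at least one user). For a permutation $\pi$ of $[K]$, $\pi\boldsymbol{d}$ is the demand in which user $\pi(k)$ requests $W_{d_k}$, i.e. $(\pi\boldsymbol d)_k=d_{\pi^{-1}(k)}$. Caching scheme for $(M,R)$, where $M,R\ge 0$ are real: cache contents $Z_1,\dots,Z_K$, each a function of $(W_1,\dots,W_N)$ of size at most $M$ (so $H(Z_k)\le M$), chosen without knowledge of the demand, and for each $\boldsymbol d\in\boldsymbol D$ a broadcast $X_{\boldsymbol d}$, a function of $(W_1,\dots,W_N)$ of size at most $R$ (so $H(X_{\boldsymbol d})\le R$), such that for every $\boldsymbol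 d\in\boldsymbol D$ and $k\in[K]$ the file $W_{d_k}$ is a function of $(Z_k,X_{\boldsymbol d})$. For $S\subseteq[K]$, $Z_S=(Z_k)_{k\in S}$. Standing assumption: only symmetric schemes are considered, i.e. schemes with $H(W_A,Z_{\pi(S)},X_{\pi\boldsymbol d})=H(W_A,Z_S,X_{\boldsymbol d})$ for all $A\subseteq[N]$, $S\subseteq[K]$, $\boldsymbol d\in\boldsymbol D$ and all permutations $\pi$ of $[K]$. The pair $(M,R)$ is achievable if there is a (symmetric) caching scheme for $(M,R)$. *)

theory Defs
  imports "HOL-Probability.Probability"
begin

text \<open>A library assigns to each index in \<open>{1..N}\<close> a bit string of length \<open>F\<close>; under the uniform
  measure on libraries the files are independent and uniformly distributed.\<close>

definition libraries :: "nat \<Rightarrow> nat \<Rightarrow> (nat \<Rightarrow> bool list) set" where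
  "libraries N F = {1..N} \<rightarrow>\<^sub>E {w. length w = F}"

definition library_space :: "nat \<Rightarrow> nat \<Rightarrow> (nat \<Rightarrow> bool list) measure" where
  "library_space N F = uniform_count_measure (libraries N F)"

lemma information_space_library_space: "information_space (library_space N F) 2"
proof -
  have fin: "finite {w :: bool list. length w = F}"
    using finite_lists_length_eq[of "UNIV :: bool set" F] by simp
  have ne: "{w :: bool list. length w = F} \<noteq> {}"
    using length_replicate[of F True] by blast
  have "prob_space (library_space N F)"
    unfolding library_space_def libraries_def
    by (rule prob_space_uniform_count_measure) (use fin ne in \<open>auto simp: finite_PiE PiE_eq_empty_iff\<close>)
  then show ?thesis
    by (simp add: information_space_def information_space_axioms_def)
qed

text \<open>Entropy and size are measured in units of \<open>F\<close> bits. The value \<open>Y w\<close> may be any code word: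
  content that takes at most \<open>2 powr (M * F)\<close> different values has size at most \<open>M\<close>, whether or not
  \<open>M * F\<close> is an integer.\<close>

definition file_entropy :: "nat \<Rightarrow> nat \<Rightarrow> ((nat \<Rightarrow> bool list) \<Rightarrow> 'c) \<Rightarrow> real" where
  "file_entropy N F Y =
     prob_space.entropy (library_space N F) 2 (count_space (Y ` libraries N F)) Y / real F"

definition content_size :: "nat \<Rightarrow> nat \<Rightarrow> ((nat \<Rightarrow> bool list) \<Rightarrow> 'c) \<Rightarrow> real" where
  "content_size N F Y = log 2 (real (card (Y ` libraries N F))) / real F"

definition demands :: "nat \<Rightarrow> nat \<Rightarrow> (nat \<Rightarrow> nat) set" where
  "demands N K = {d \<in> {1..K} \<rightarrow>\<^sub>E {1..N}. d ` {1..K} = {1..N}}"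

definition permute_demand :: "(nat \<Rightarrow> nat) \<Rightarrow> (nat \<Rightarrow> nat) \<Rightarrow> nat \<Rightarrow> nat" where
  "permute_demand \<pi> d = d \<circ> inv \<pi>"

text \<open>\<open>Z k w\<close> is the cache content of user \<open>k\<close> and \<open>X d w\<close> the broadcast for demand \<open>d\<close> when the
  library is \<open>w\<close>. The decoder \<open>\<phi>\<close> may depend on the user and on the demand.\<close>

definition caching_scheme ::
  "nat \<Rightarrow> nat \<Rightarrow> nat \<Rightarrow> real \<Rightarrow> real \<Rightarrow>
   (nat \<Rightarrow> (nat \<Rightarrow> bool list) \<Rightarrow> bool list) \<Rightarrow>
   ((nat \<Rightarrow> nat) \<Rightarrow> (nat \<Rightarrow> bool list) \<Rightarrow> bool list) \<Rightarrow> bool" where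
  "caching_scheme N K F M R Z X \<longleftrightarrow>
     (\<forall>k\<in>{1..K}. content_size N F (Z k) \<le> M) \<and>
     (\<forall>d\<in>demands N K. content_size N F (X d) \<le> R) \<and>
     (\<forall>d\<in>demands N K. \<forall>k\<in>{1..K}. \<exists>\<phi>. \<forall>w\<in>libraries N F. \<phi> (Z k w) (X d w) = w (d k))"

definition joint_entropy ::
  "nat \<Rightarrow> nat \<Rightarrow> (nat \<Rightarrow> (nat \<Rightarrow> bool list) \<Rightarrow> bool list) \<Rightarrow>
   ((nat \<Rightarrow> nat) \<Rightarrow> (nat \<Rightarrow> bool list) \<Rightarrow> bool list) \<Rightarrow>
   nat set \<Rightarrow> nat set \<Rightarrow> (nat \<Rightarrow> nat) \<Rightarrow> real" where
  "joint_entropy N F Z X A S d =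
     file_entropy N F (\<lambda>w. (restrict w A, restrict (\<lambda>k. Z k w) S, X d w))"

definition symmetric_scheme ::
  "nat \<Rightarrow> nat \<Rightarrow> nat \<Rightarrow>
   (nat \<Rightarrow> (nat \<Rightarrow> bool list) \<Rightarrow> bool list) \<Rightarrow>
   ((nat \<Rightarrow> nat) \<Rightarrow> (nat \<Rightarrow> bool list) \<Rightarrow> bool list) \<Rightarrow> bool" where
  "symmetric_scheme N K F Z X \<longleftrightarrow>
     (\<forall>A S d \<pi>. A \<subseteq> {1..N} \<longrightarrow> S \<subseteq> {1..K} \<longrightarrow> d \<in> demands N K \<longrightarrow> \<pi> permutes {1..K} \<longrightarrow>
        joint_entropy N F Z X A (\<pi> ` S) (permute_demand \<pi> d) = joint_entropy N F Z X A S d)"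

definition achievable :: "nat \<Rightarrow> nat \<Rightarrow> real \<Rightarrow> real \<Rightarrow> bool" where
  "achievable N K M R \<longleftrightarrow> 0 \<le> M \<and> 0 \<le> R \<and>
     (\<exists>F Z X. 0 < F \<and> caching_scheme N K F M R Z X \<and> symmetric_scheme N K F Z X)"

end

theory Submission
  imports Defs
begin

text \<open>Put \<open>N = n + 1\<close> and \<open>A = {1..n}\<close>, and let \<open>h j = H(W_A, Z_{1..j}, X_d)\<close> for a demand \<open>d\<close> in
  which user \<open>j + 1\<close> requests the last file \<open>N\<close>. That user completes the library, so submodularity
  gives \<open>N + H(W_A, Z_{1..j}) \<le> H(W_A, Z_{1..j+1}) + h j\<close>; chaining over \<open>j\<close> yields
  \<open>\<Sum>j<K. h j \<ge> K N - 1\<close>.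

  For the upper bound, a broadcast together with \<open>n\<close> caches whose users request all of \<open>A\<close> costs
  at most \<open>G = R + n M\<close>. Two such cache sets with the same broadcast give
  \<open>h (n + i) + h (n - i) \<le> 2 G\<close> for \<open>i \<le> n\<close>. For \<open>j > 2 n\<close>, users who request the file \<open>n\<close> are added
  one at a time; every addition costs \<open>G\<close> and returns a term \<open>H(W_A, Z_S, X_d) \<ge> N - M\<close>. Adding up
  gives the theorem for \<open>N \<ge> 2\<close>; for \<open>N = 1\<close> the range of \<open>M\<close> is a single point.\<close>

section \<open>Entropy of simple functions: submodularity and functional dependence\<close>

context information_space begin

lemma sum_prob_image:
  assumes X: "simple_function M X"
  shows "(\<Sum>y\<in>(\<lambda>w. f (X w)) ` space M. prob ((\<lambda>w. f (X w)) -` {y} \<inter> space M) * g y) =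
    (\<Sum>x\<in>X ` space M. prob (X -` {x} \<inter> space M) * g (f x))"
proof -
  have fin: "finite (X ` space M)"
    using X by (simp add: simple_functionD)
  have "prob ((\<lambda>w. f (X w)) -` {y} \<inter> space M) =
      (\<Sum>x\<in>{x \<in> X ` space M. f x = y}. prob (X -` {x} \<inter> space M))" for y
  proof -
    have "(\<lambda>w. f (X w)) -` {y} \<inter> space M = (\<Union>x\<in>{x \<in> X ` space M. f x = y}. X -` {x} \<inter> space M)"
      by auto
    also have "prob \<dots> = (\<Sum>x\<in>{x \<in> X ` space M. f x = y}. prob (X -` {x} \<inter> space M))"
      using fin simple_functionD(2)[OF X]
      by (intro finite_measure_finite_Union) (auto simp: disjoint_family_on_def)
    finally show ?thesis .
  qed
  then have "(\<Sum>y\<in>(\<lambda>w. f (X w)) ` space M. prob ((\<lambda>w. f (X w)) -` {y} \<inter> space M) * g y) =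
      (\<Sum>y\<in>f ` X ` space M. \<Sum>x\<in>{x \<in> X ` space M. f x = y}. prob (X -` {x} \<inter> space M) * g (f x))"
    by (auto simp: image_image sum_distrib_right intro!: sum.cong)
  also have "\<dots> = (\<Sum>x\<in>X ` space M. prob (X -` {x} \<inter> space M) * g (f x))"
    by (rule sum.image_gen[OF fin, symmetric])
  finally show ?thesis .
qed

lemma entropy_image_eq_sum:
  assumes X: "simple_function M X"
  shows "\<H>(\<lambda>w. f (X w)) =
    - (\<Sum>x\<in>X ` space M. prob (X -` {x} \<inter> space M) * log b (prob ((\<lambda>w. f (X w)) -` {f x} \<inter> space M)))"
proof -
  have "simple_function M (\<lambda>w. f (X w))"
    using simple_function_compose[OF X, of f] by (simp add: comp_def)
  from entropy_simple_distributed[OF simple_distributedI[OF this measure_nonneg refl]] show ?thesis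
    by (simp only: sum_prob_image[OF X,
        of f "\<lambda>y. log b (prob ((\<lambda>w. f (X w)) -` {y} \<inter> space M))"])
qed

text \<open>This is \<open>\<I>(X ; Y | Z) \<ge> 0\<close>: expanded over the values of the triple,
  the conditional mutual information splits into four entropies.\<close>

lemma entropy_submodular:
  assumes X: "simple_function M X" and Y: "simple_function M Y" and Z: "simple_function M Z"
  shows "\<H>(\<lambda>w. (X w, Y w, Z w)) + \<H>(Z) \<le> \<H>(\<lambda>w. (X w, Z w)) + \<H>(\<lambda>w. (Y w, Z w))"
proof -
  let ?T = "\<lambda>w. (X w, Y w, Z w)"
  let ?p = "\<lambda>V v. prob (V -` {v} \<inter> space M)"
  have T: "simple_function M ?T"
    by (intro simple_function_Pair X Y Z)
  note sd = simple_distributedI[OF _ measure_nonneg refl]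
  \<comment> \<open>Each marginal event contains the atom of the triple, so it is non-null whenever
    the atom is. This licenses splitting the logarithm of the quotient.\<close>
  have pos: "0 < prob ((\<lambda>w. f (?T w)) -` {f t} \<inter> space M)"
    if "?p ?T t \<noteq> 0" for t and f :: "_ \<Rightarrow> 'z"
  proof -
    have "simple_function M (\<lambda>w. f (?T w))"
      using simple_function_compose[OF T, of f] by (simp add: comp_def)
    then have "?p ?T t \<le> prob ((\<lambda>w. f (?T w)) -` {f t} \<inter> space M)"
      by (intro finite_measure_mono) (auto dest: simple_functionD(2))
    then show ?thesis
      using that measure_nonneg[of M "?T -` {t} \<inter> space M"] by linarith
  qed
  have "0 \<le> \<I>(X ; Y | Z)"
    by (rule conditional_mutual_information_nonneg[OF X Y Z])
  also have "\<dots> = (\<Sum>t\<in>?T ` space M. ?p ?T t * log b (?p ?T t /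
      (?p (\<lambda>w. (X w, Z w)) (fst t, snd (snd t)) *
        (?p (\<lambda>w. (Y w, Z w)) (fst (snd t), snd (snd t)) / ?p Z (snd (snd t))))))"
    by (subst conditional_mutual_information_eq[OF sd sd sd sd])
      (auto intro!: simple_function_Pair X Y Z sum.cong)
  also have "\<dots> = (\<Sum>t\<in>?T ` space M.
      ?p ?T t * log b (?p ?T t) + ?p ?T t * log b (?p Z (snd (snd t)))
      - ?p ?T t * log b (?p (\<lambda>w. (X w, Z w)) (fst t, snd (snd t)))
      - ?p ?T t * log b (?p (\<lambda>w. (Y w, Z w)) (fst (snd t), snd (snd t))))"
  proof (rule sum.cong[OF refl], goal_cases)
    case (1 t)
    \<comment> \<open>On null atoms the factor in front of every logarithm is 0, so the value of
      \<open>log b 0\<close> does not matter.\<close>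
    show ?case
    proof (cases "?p ?T t = 0")
      case False
      then have "0 < ?p ?T t"
        using measure_nonneg[of M "?T -` {t} \<inter> space M"] by linarith
      then show ?thesis
        using pos[OF False, of "\<lambda>t. snd (snd t)"] pos[OF False, of "\<lambda>t. (fst t, snd (snd t))"]
          pos[OF False, of "\<lambda>t. (fst (snd t), snd (snd t))"] b_gt_1
        by (simp add: log_mult log_divide algebra_simps)
    qed simp
  qed
  also have "\<dots> = \<H>(\<lambda>w. (X w, Z w)) + \<H>(\<lambda>w. (Y w, Z w)) - \<H>(?T) - \<H>(Z)"
    using entropy_image_eq_sum[OF T, of "\<lambda>t. t"] entropy_image_eq_sum[OF T, of "\<lambda>t. snd (snd t)"]
      entropy_image_eq_sum[OF T, of "\<lambda>t. (fst t, snd (snd t))"]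
      entropy_image_eq_sum[OF T, of "\<lambda>t. (fst (snd t), snd (snd t))"]
    by (simp add: sum.distrib sum_subtractf)
  finally show ?thesis by simp
qed

text \<open>On \<open>space M\<close>, \<open>V\<close> factors through \<open>U\<close>, so data
  processing applies.\<close>

lemma entropy_mono_determined:
  assumes U: "simple_function M U"
    and det: "\<And>w w'. w \<in> space M \<Longrightarrow> w' \<in> space M \<Longrightarrow> U w = U w' \<Longrightarrow> V w = V w'"
  shows "\<H>(V) \<le> \<H>(U)"
proof -
  \<comment> \<open>\<open>f\<close> evaluates \<open>V\<close> at a chosen representative of each
    fibre of \<open>U\<close>; by \<open>det\<close> the choice is immaterial.\<close>
  define f where "f = V \<circ> inv_into (space M) U"
  have V: "V w = (f \<circ> U) w" if "w \<in> space M" for w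
    using that by (auto simp: f_def intro!: det simp: inv_into_into f_inv_into_f)
  have "\<H>(V) = \<H>(f \<circ> U)"
  proof -
    have im: "V ` space M = (f \<circ> U) ` space M" using V by (intro image_cong) auto
    have "distr M (count_space (V ` space M)) V = distr M (count_space (V ` space M)) (f \<circ> U)"
      using V by (intro distr_cong) auto
    then show ?thesis
      unfolding entropy_def im[symmetric] by simp
  qed
  also have "\<dots> \<le> \<H>(U)"
    by (rule entropy_data_processing[OF U])
  finally show ?thesis .
qed

text \<open>\<open>entropy_submodular\<close> conditioned on \<open>I\<close>: adjoining
  \<open>I\<close> to \<open>U\<close> or to \<open>V\<close> adds no entropy, and the triple
  determines \<open>T\<close>. So \<open>I\<close> acts as an intersection and \<open>T\<close> as a
  union.\<close>

lemma entropy_submodular_determined: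
  assumes U: "simple_function M U" and V: "simple_function M V"
    and I: "\<And>w w'. w \<in> space M \<Longrightarrow> w' \<in> space M \<Longrightarrow> U w = U w' \<Longrightarrow> I w = I w'"
      "\<And>w w'. w \<in> space M \<Longrightarrow> w' \<in> space M \<Longrightarrow> V w = V w' \<Longrightarrow> I w = I w'"
    and T: "\<And>w w'. w \<in> space M \<Longrightarrow> w' \<in> space M \<Longrightarrow> U w = U w' \<Longrightarrow> V w = V w' \<Longrightarrow> T w = T w'"
    and sI: "simple_function M I"
  shows "\<H>(T) + \<H>(I) \<le> \<H>(U) + \<H>(V)"
proof -
  have "\<H>(T) \<le> \<H>(\<lambda>w. (U w, V w, I w))"
    by (intro entropy_mono_determined simple_function_Pair U V sI) (auto intro: T)
  moreover have "\<H>(\<lambda>w. (U w, I w)) \<le> \<H>(U)"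
    by (intro entropy_mono_determined U) (auto intro: I)
  moreover have "\<H>(\<lambda>w. (V w, I w)) \<le> \<H>(V)"
    by (intro entropy_mono_determined V) (auto intro: I)
  ultimately show ?thesis
    using entropy_submodular[OF U V sI] by linarith
qed

end

section \<open>Entropy in units of one file\<close>

lemma finite_libraries: "finite (libraries N F)"
  using finite_lists_length_eq[of "UNIV :: bool set" F] by (auto simp: libraries_def intro!: finite_PiE)

lemma card_libraries: "card (libraries N F) = 2 ^ (F * N)"
  using card_lists_length_eq[of "UNIV :: bool set" F]
  by (simp add: libraries_def card_PiE power_mult)

lemma space_library_space: "space (library_space N F) = libraries N F"
  by (simp add: library_space_def space_uniform_count_measure)

lemma simple_function_library_space: "simple_function (library_space N F) Y"
  by (auto simp: simple_function_def space_library_space finite_libraries)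
    (auto simp: library_space_def sets_uniform_count_measure)

text \<open>Functional dependence without naming the function, so that recoverability is checked on
  pairs of libraries.\<close>

definition determines :: "nat \<Rightarrow> nat \<Rightarrow> ((nat \<Rightarrow> bool list) \<Rightarrow> 'c) \<Rightarrow> ((nat \<Rightarrow> bool list) \<Rightarrow> 'd) \<Rightarrow> bool" where
  "determines N F U V \<longleftrightarrow> (\<forall>w\<in>libraries N F. \<forall>w'\<in>libraries N F. U w = U w' \<longrightarrow> V w = V w')"

lemma file_entropy_mono:
  assumes "determines N F U V"
  shows "file_entropy N F V \<le> file_entropy N F U"
proof -
  interpret information_space "library_space N F" 2 by (rule information_space_library_space)
  have "entropy 2 (count_space (V ` libraries N F)) V \<le> entropy 2 (count_space (U ` libraries N F)) U"
    by (rule entropy_mono_determined[OF simple_function_library_space, unfolded space_library_space])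
      (use assms[unfolded determines_def] in blast)+
  then show ?thesis
    unfolding file_entropy_def by (rule divide_right_mono) simp
qed

lemma file_entropy_submodular:
  assumes "determines N F U I" and "determines N F V I" and "determines N F (\<lambda>w. (U w, V w)) T"
  shows "file_entropy N F T + file_entropy N F I \<le> file_entropy N F U + file_entropy N F V"
proof -
  interpret information_space "library_space N F" 2 by (rule information_space_library_space)
  have "entropy 2 (count_space (T ` libraries N F)) T + entropy 2 (count_space (I ` libraries N F)) I
      \<le> entropy 2 (count_space (U ` libraries N F)) U + entropy 2 (count_space (V ` libraries N F)) V"
    by (rule entropy_submodular_determined[OF simple_function_library_space
          simple_function_library_space _ _ _ simple_function_library_space, unfolded space_library_space])
      (use assms[unfolded determines_def] in blast)+
  then show ?thesis
    unfolding file_entropy_def add_divide_distrib[symmetric] by (rule divide_right_mono) simp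
qed

lemma file_entropy_le_content_size: "file_entropy N F Y \<le> content_size N F Y"
proof -
  interpret information_space "library_space N F" 2 by (rule information_space_library_space)
  show ?thesis
    unfolding file_entropy_def content_size_def
    using entropy_le_card[OF simple_distributedI[OF simple_function_library_space[of N F Y] measure_nonneg refl]]
    by (auto simp: space_library_space intro!: divide_right_mono)
qed

text \<open>Submodularity with a constant, of entropy 0, as the common part.\<close>

lemma file_entropy_subadd:
  assumes "determines N F (\<lambda>w. (U w, V w)) T"
  shows "file_entropy N F T \<le> file_entropy N F U + file_entropy N F V"
proof -
  interpret information_space "library_space N F" 2 by (rule information_space_library_space)
  have "file_entropy N F (\<lambda>w. 0 :: nat) = 0"
    using entropy_image_eq_sum[OF simple_function_library_space, of "\<lambda>_. 0 :: nat" "\<lambda>_. 0 :: nat"]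
    prob_space
    by (simp add: file_entropy_def space_library_space)
  moreover have "determines N F U (\<lambda>w. 0 :: nat)" "determines N F V (\<lambda>w. 0 :: nat)"
    by (simp_all add: determines_def)
  ultimately show ?thesis
    using file_entropy_submodular[OF _ _ assms, of "\<lambda>w. 0 :: nat"] by simp
qed

text \<open>The library is uniform on \<open>2 ^ (F * N)\<close> values, and \<open>Y\<close>
  reveals all of it.\<close>

lemma file_entropy_all:
  assumes "0 < F" and "determines N F Y (\<lambda>w. w)"
  shows "real N \<le> file_entropy N F Y"
proof -
  interpret information_space "library_space N F" 2 by (rule information_space_library_space)
  have "entropy 2 (count_space ((\<lambda>w. w) ` libraries N F)) (\<lambda>w. w) = real (F * N)"
  proof -
    have "prob ((\<lambda>w. w) -` {w} \<inter> libraries N F) = 1 / 2 ^ (F * N)" if "w \<in> libraries N F" for w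
      using that by (simp add: library_space_def measure_uniform_count_measure finite_libraries card_libraries)
    then show ?thesis
      using entropy_image_eq_sum[OF simple_function_library_space, of "\<lambda>w. w" "\<lambda>w. w"]
      by (simp add: space_library_space card_libraries log_divide log_nat_power)
  qed
  then have "file_entropy N F (\<lambda>w. w) = real N"
    using assms(1) by (simp add: file_entropy_def)
  then show ?thesis
    using file_entropy_mono[OF assms(2)] by simp
qed


section \<open>Entropy bounds for a fixed symmetric scheme\<close>

lemma restrict_eq_iff: "restrict f A = restrict g A \<longleftrightarrow> (\<forall>x\<in>A. f x = g x)"
  by (auto simp: restrict_def fun_eq_iff)

lemma libraries_eqI:
  assumes "w \<in> libraries N F" and "w' \<in> libraries N F" and "\<And>i. i \<in> {1..N} \<Longrightarrow> w i = w' i"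
  shows "w = w'"
  using assms unfolding libraries_def by (rule PiE_ext)

locale symmetric_caching =
  fixes N K F :: nat and M R :: real
    and Z :: "nat \<Rightarrow> (nat \<Rightarrow> bool list) \<Rightarrow> bool list"
    and X :: "(nat \<Rightarrow> nat) \<Rightarrow> (nat \<Rightarrow> bool list) \<Rightarrow> bool list"
  assumes F_pos: "0 < F"
    and scheme: "caching_scheme N K F M R Z X"
    and symmetric: "symmetric_scheme N K F Z X"
begin

abbreviation entropyX :: "nat set \<Rightarrow> nat set \<Rightarrow> (nat \<Rightarrow> nat) \<Rightarrow> real" where
  "entropyX \<equiv> joint_entropy N F Z X"

definition entropyZ :: "nat set \<Rightarrow> nat set \<Rightarrow> real" where
  "entropyZ A S = file_entropy N F (\<lambda>w. (restrict w A, restrict (\<lambda>k. Z k w) S))"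

lemma decode:
  assumes "d \<in> demands N K" and "k \<in> {1..K}" and "w \<in> libraries N F" and "w' \<in> libraries N F"
    and "Z k w = Z k w'" and "X d w = X d w'"
  shows "w (d k) = w' (d k)"
  using scheme assms unfolding caching_scheme_def by metis

lemma file_entropy_Z_le: "k \<in> {1..K} \<Longrightarrow> file_entropy N F (Z k) \<le> M"
  using scheme file_entropy_le_content_size order_trans unfolding caching_scheme_def by blast

lemma file_entropy_X_le: "d \<in> demands N K \<Longrightarrow> file_entropy N F (X d) \<le> R"
  using scheme file_entropy_le_content_size order_trans unfolding caching_scheme_def by blast

text \<open>The users in \<open>S\<close> decode all of \<open>A\<close>, so the files cost nothing
  beyond the caches and the broadcast.\<close>

lemma entropyX_le:
  assumes d: "d \<in> demands N K" and S: "S \<subseteq> {1..K}" and A: "A \<subseteq> d ` S"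
  shows "entropyX A S d \<le> R + real (card S) * M"
proof -
  have "entropyX A S d \<le> file_entropy N F (\<lambda>w. (restrict (\<lambda>k. Z k w) S, X d w))"
    unfolding joint_entropy_def
  proof (rule file_entropy_mono, unfold determines_def, intro ballI impI)
    fix w w' assume w: "w \<in> libraries N F" "w' \<in> libraries N F"
      and eq: "(restrict (\<lambda>k. Z k w) S, X d w) = (restrict (\<lambda>k. Z k w') S, X d w')"
    have "w i = w' i" if "i \<in> A" for i
    proof -
      obtain k where "k \<in> S" "i = d k"
        using A \<open>i \<in> A\<close> by auto
      then show ?thesis
        using eq S decode[OF d _ w, of k] by (auto simp: restrict_eq_iff)
    qed
    then show "(restrict w A, restrict (\<lambda>k. Z k w) S, X d w) = (restrict w' A, restrict (\<lambda>k. Z k w') S, X d w')"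
      using eq by (simp add: restrict_eq_iff)
  qed
  \<comment> \<open>The files have been dropped, so \<open>S\<close> can be built up one cache at a
    time.\<close>
  also have "\<dots> \<le> R + real (card S) * M"
    using finite_subset[OF S finite_atLeastAtMost] S
  proof (induction S rule: finite_induct)
    case empty
    have "file_entropy N F (\<lambda>w. (restrict (\<lambda>k. Z k w) {}, X d w)) \<le> file_entropy N F (X d)"
      by (rule file_entropy_mono) (auto simp: determines_def restrict_eq_iff)
    also have "\<dots> \<le> R"
      by (rule file_entropy_X_le[OF d])
    finally show ?case
      by (simp only: card.empty of_nat_0 mult_zero_left add_0_right)
  next
    case (insert k S)
    have "file_entropy N F (\<lambda>w. (restrict (\<lambda>k. Z k w) (insert k S), X d w))
      \<le> file_entropy N F (Z k) + file_entropy N F (\<lambda>w. (restrict (\<lambda>k. Z k w) S, X d w))"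
      by (rule file_entropy_subadd) (auto simp: determines_def restrict_eq_iff)
    also have "\<dots> \<le> M + (R + real (card S) * M)"
      by (intro add_mono file_entropy_Z_le insert.IH) (use insert.prems in auto)
    also have "\<dots> = R + real (card (insert k S)) * M"
      using insert by (simp add: algebra_simps)
    finally show ?case .
  qed
  finally show ?thesis .
qed

lemma entropyX_submodular:
  "entropyX A (S \<union> T) d + entropyX A (S \<inter> T) d \<le> entropyX A S d + entropyX A T d"
  unfolding joint_entropy_def
  by (rule file_entropy_submodular) (auto simp: determines_def restrict_eq_iff)

lemma entropyZ_le_entropyX: "entropyZ A S \<le> entropyX A S d"
  unfolding joint_entropy_def entropyZ_def
  by (rule file_entropy_mono) (auto simp: determines_def)

text \<open>Submodularity for \<open>(W_A, Z_I)\<close> and \<open>(W_A, Z_J, X_d)\<close>: jointly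
  they reveal the whole library, since the users in \<open>I\<close> decode what \<open>A\<close>
  leaves out, and they share \<open>(W_A, Z_(I \<inter> J))\<close>.\<close>

lemma entropyZ_decode:
  assumes d: "d \<in> demands N K" and I: "I \<subseteq> {1..K}" and cover: "{1..N} \<subseteq> A \<union> d ` I"
  shows "real N + entropyZ A (I \<inter> J) \<le> entropyZ A I + entropyX A J d"
proof -
  let ?U = "\<lambda>w. (restrict w A, restrict (\<lambda>k. Z k w) I)"
  let ?V = "\<lambda>w. (restrict w A, restrict (\<lambda>k. Z k w) J, X d w)"
  have "real N \<le> file_entropy N F (\<lambda>w. (?U w, ?V w))"
  proof (rule file_entropy_all[OF F_pos], unfold determines_def, intro ballI impI)
    fix w w' assume w: "w \<in> libraries N F" "w' \<in> libraries N F" and eq: "(?U w, ?V w) = (?U w', ?V w')"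
    show "w = w'"
    proof (rule libraries_eqI[OF w])
      fix i assume "i \<in> {1..N}"
      then consider "i \<in> A" | k where "k \<in> I" "i = d k"
        using cover by auto
      then show "w i = w' i"
        using eq I by cases (auto simp: restrict_eq_iff intro!: decode[OF d _ w])
    qed
  qed
  moreover have "file_entropy N F (\<lambda>w. (?U w, ?V w)) + entropyZ A (I \<inter> J) \<le> entropyZ A I + entropyX A J d"
    unfolding joint_entropy_def entropyZ_def
    by (rule file_entropy_submodular) (auto simp: determines_def restrict_eq_iff)
  ultimately show ?thesis by linarith
qed

text \<open>Adding the single cache \<open>Z k\<close>, of entropy at most \<open>M\<close>,
  completes the library.\<close>

lemma entropyX_ge:
  assumes d: "d \<in> demands N K" and k: "k \<in> {1..K}" and cover: "{1..N} \<subseteq> insert (d k) A"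
  shows "real N \<le> entropyX A S d + M"
proof -
  let ?V = "\<lambda>w. (restrict w A, restrict (\<lambda>k. Z k w) S, X d w)"
  have "real N \<le> file_entropy N F (\<lambda>w. (Z k w, ?V w))"
  proof (rule file_entropy_all[OF F_pos], unfold determines_def, intro ballI impI)
    fix w w' assume w: "w \<in> libraries N F" "w' \<in> libraries N F" and eq: "(Z k w, ?V w) = (Z k w', ?V w')"
    show "w = w'"
    proof (rule libraries_eqI[OF w])
      fix i assume "i \<in> {1..N}"
      then consider "i \<in> A" | "i = d k"
        using cover by auto
      then show "w i = w' i"
        using eq k by cases (auto simp: restrict_eq_iff intro!: decode[OF d _ w])
    qed
  qed
  also have "\<dots> \<le> file_entropy N F (Z k) + entropyX A S d"
    unfolding joint_entropy_def by (rule file_entropy_subadd) (auto simp: determines_def)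
  finally show ?thesis
    using file_entropy_Z_le[OF k] by linarith
qed

text \<open>At most the file \<open>n\<close> is missing, and it has size 1.\<close>

lemma entropyZ_ge:
  assumes n: "n \<in> {1..N}" and cover: "{1..N} \<subseteq> insert n A"
  shows "real N \<le> entropyZ A S + 1"
proof -
  let ?U = "\<lambda>w. (restrict w A, restrict (\<lambda>k. Z k w) S)"
  have "real N \<le> file_entropy N F (\<lambda>w. (?U w, w n))"
  proof (rule file_entropy_all[OF F_pos], unfold determines_def, intro ballI impI)
    fix w w' assume w: "w \<in> libraries N F" "w' \<in> libraries N F" and eq: "(?U w, w n) = (?U w', w' n)"
    show "w = w'"
      using eq cover by (intro libraries_eqI[OF w]) (auto simp: restrict_eq_iff)
  qed
  also have "\<dots> \<le> entropyZ A S + file_entropy N F (\<lambda>w. w n)"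
    unfolding entropyZ_def by (rule file_entropy_subadd) (auto simp: determines_def)
  also have "file_entropy N F (\<lambda>w. w n) \<le> 1"
  proof (rule order_trans[OF file_entropy_le_content_size])
    let ?L = "{w :: bool list. length w = F}"
    have "finite ?L" "card ?L = 2 ^ F"
      using finite_lists_length_eq[of "UNIV :: bool set" F] card_lists_length_eq[of "UNIV :: bool set" F] by auto
    moreover have sub: "(\<lambda>w. w n) ` libraries N F \<subseteq> ?L"
      using n by (auto simp: libraries_def)
    ultimately have le: "card ((\<lambda>w. w n) ` libraries N F) \<le> 2 ^ F"
      using card_mono by metis
    have ne: "libraries N F \<noteq> {}"
      using card_libraries[of N F] by auto
    then have "0 < card ((\<lambda>w. w n) ` libraries N F)"
      by (simp add: card_gt_0_iff finite_libraries)
    then have "log 2 (real (card ((\<lambda>w. w n) ` libraries N F))) \<le> log 2 (2 ^ F)"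
      using le by (subst log_le_cancel_iff) (auto simp flip: of_nat_le_iff)
    then show "content_size N F (\<lambda>w. w n) \<le> 1"
      using F_pos by (simp add: content_size_def log_nat_power)
  qed
  finally show ?thesis by simp
qed

lemma entropyX_permute:
  assumes "A \<subseteq> {1..N}" and "S \<subseteq> {1..K}" and "d \<in> demands N K" and "\<pi> permutes {1..K}"
  shows "entropyX A (\<pi> ` S) (permute_demand \<pi> d) = entropyX A S d"
  using symmetric assms unfolding symmetric_scheme_def by blast

end

section \<open>Demands and telescoping\<close>

lemma permute_demand_in_demands:
  assumes d: "d \<in> demands N K" and \<pi>: "\<pi> permutes {1..K}"
  shows "permute_demand \<pi> d \<in> demands N K"
proof -
  have inv: "inv \<pi> permutes {1..K}"
    by (rule permutes_inv[OF \<pi>])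
  \<comment> \<open>\<open>inv \<pi>\<close> fixes every index outside \<open>{1..K}\<close>, so the
    default value of an extensional demand survives there.\<close>
  have "d (inv \<pi> k) = undefined" if "k \<notin> {1..K}" for k
    using that d permutes_not_in[OF inv that] by (auto simp: demands_def PiE_def extensional_def)
  moreover have "d (inv \<pi> k) \<in> {1..N}" if "k \<in> {1..K}" for k
    using that d permutes_in_image[OF inv, of k] by (auto simp: demands_def)
  moreover have "(d \<circ> inv \<pi>) ` {1..K} = {1..N}"
    using d permutes_image[OF inv] by (simp only: demands_def mem_Collect_eq image_comp[symmetric])
  ultimately show ?thesis
    by (auto simp: demands_def permute_demand_def)
qed

text \<open>User \<open>j + 1\<close> is the first to want the last file. The first \<open>n\<close>
  users already request every other file, so \<open>e\<close> is free to repeat requests among users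
  \<open>n + 1\<close> to \<open>j\<close>.\<close>

definition tail_demand :: "nat \<Rightarrow> nat \<Rightarrow> nat \<Rightarrow> (nat \<Rightarrow> nat) \<Rightarrow> nat \<Rightarrow> nat" where
  "tail_demand n K j e = (\<lambda>k\<in>{1..K}. if k \<le> n then k else if k \<le> j then e k else Suc n)"

lemma tail_demand_in_demands:
  assumes "n \<le> j" and "j < K" and e: "\<And>k. n < k \<Longrightarrow> k \<le> j \<Longrightarrow> e k \<in> {1..n}"
  shows "tail_demand n K j e \<in> demands (Suc n) K"
proof -
  have "i \<in> tail_demand n K j e ` {1..K}" if "i \<in> {1..Suc n}" for i
  proof (cases "i \<le> n")
    case True
    then show ?thesis
      using that assms by (intro image_eqI[of _ _ i]) (auto simp: tail_demand_def)
  next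
    case False
    \<comment> \<open>Only \<open>i = n + 1\<close> is left; user \<open>K\<close> requests it
      because \<open>j < K\<close>.\<close>
    then show ?thesis
      using that assms by (intro image_eqI[of _ _ K]) (auto simp: tail_demand_def)
  qed
  moreover have "tail_demand n K j e k \<in> {1..Suc n}" if "k \<in> {1..K}" for k
    using that e[of k] by (auto simp: tail_demand_def)
  ultimately have "tail_demand n K j e ` {1..K} = {1..Suc n}"
    by blast
  moreover have "tail_demand n K j e \<in> extensional {1..K}"
    by (simp add: tail_demand_def)
  ultimately show ?thesis
    by (auto simp: demands_def PiE_def)
qed

lemma chain_sum_le:
  fixes c \<beta> :: "nat \<Rightarrow> real"
  assumes "\<And>j. j < m \<Longrightarrow> a + c j \<le> c (Suc j) + \<beta> j"
  shows "real m * a + c 0 \<le> c m + (\<Sum>j<m. \<beta> j)"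
  using assms
proof (induction m)
  case (Suc m)
  then have "real m * a + c 0 \<le> c m + (\<Sum>j<m. \<beta> j)" and "a + c m \<le> c (Suc m) + \<beta> m"
    by simp_all
  then show ?case
    by (simp add: algebra_simps)
qed simp

section \<open>Lower and upper bounds for the chain\<close>

context symmetric_caching
begin

text \<open>One link of the chain: \<open>entropyZ_decode\<close> for \<open>{1..j + 1}\<close>
  against \<open>{1..j}\<close>.\<close>

lemma entropyZ_decode_last:
  assumes "N = Suc n" and "d \<in> demands N K" and "Suc j \<le> K" and "d (Suc j) = N"
  shows "real N + entropyZ {1..n} {1..j} \<le> entropyZ {1..n} {1..Suc j} + entropyX {1..n} {1..j} d"
proof -
  have "{1..N} \<subseteq> {1..n} \<union> d ` {1..Suc j}"
    using assms(1,4) by (force simp: le_Suc_eq)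
  from entropyZ_decode[OF assms(2) _ this, of "{1..j}"] assms(3) show ?thesis
    by (simp add: Int_absorb1)
qed

lemma entropyX_pair_le:
  assumes N: "N = Suc n" and i: "i \<le> n" and K: "n + i < K"
  defines "d \<equiv> tail_demand n K (n + i) (\<lambda>k. k - i)"
  shows "entropyX {1..n} {1..n + i} d + entropyX {1..n} {1..n - i} d \<le> 2 * (R + real n * M)"
proof -
  have d: "d \<in> demands N K"
    unfolding d_def N using i K by (intro tail_demand_in_demands) auto
  \<comment> \<open>User \<open>l + i\<close> repeats the request of user \<open>l\<close> for
    \<open>n - i < l \<le> n\<close>. Exchanging these users turns \<open>?S\<close> into
    \<open>?T\<close>, which again has \<open>n\<close> caches and covers all of
    \<open>A\<close>.\<close>
  let ?S = "{1..n}" and ?T = "{1..n - i} \<union> {n + 1..n + i}"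
  have "entropyX {1..n} ?S d \<le> R + real (card ?S) * M"
    using K by (intro entropyX_le[OF d]) (auto simp: d_def tail_demand_def)
  moreover have "entropyX {1..n} ?T d \<le> R + real (card ?T) * M"
  proof (rule entropyX_le[OF d])
    show "{1..n} \<subseteq> d ` ?T"
    proof
      fix l assume l: "l \<in> {1..n}"
      show "l \<in> d ` ?T"
      proof (cases "l \<le> n - i")
        case True
        then show ?thesis
          using l K by (intro image_eqI[of _ _ l]) (auto simp: d_def tail_demand_def)
      next
        case False
        then show ?thesis
          using l K by (intro image_eqI[of _ _ "l + i"]) (auto simp: d_def tail_demand_def)
      qed
    qed
  qed (use i K in auto)
  moreover have "card ?T = n"
    using i by (subst card_Un_disjoint) auto
  moreover have "?S \<union> ?T = {1..n + i}" "?S \<inter> ?T = {1..n - i}"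
    using i by auto
  ultimately show ?thesis
    using entropyX_submodular[of "{1..n}" ?S ?T d] by simp
qed

lemma entropyX_extend_le:
  assumes N: "N = Suc n" and n: "1 \<le> n" and j: "n \<le> j" "j < K" and i: "n + i \<le> j"
  defines "d \<equiv> tail_demand n K j (\<lambda>_. n)"
  shows "entropyX {1..n} {1..n + i} d + real i * (real N - M) \<le> (real i + 1) * (R + real n * M)"
  using i
proof (induction i)
  case 0
  have d: "d \<in> demands N K"
    unfolding d_def N using n j by (intro tail_demand_in_demands) auto
  have "entropyX {1..n} {1..n} d \<le> R + real (card {1..n}) * M"
    using j by (intro entropyX_le[OF d]) (auto simp: d_def tail_demand_def)
  then show ?case by simp
next
  case (Suc i)
  have d: "d \<in> demands N K"
    unfolding d_def N using n j by (intro tail_demand_in_demands) auto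
  \<comment> \<open>In \<open>?T\<close> the new user \<open>n + i + 1\<close> stands in for user
    \<open>n\<close>, as both request file \<open>n\<close>; hence \<open>?T\<close> also costs
    \<open>R + n M\<close>.\<close>
  let ?S = "{1..n + i}" and ?T = "{1..n - 1} \<union> {Suc (n + i)}"
  have "entropyX {1..n} ?T d \<le> R + real (card ?T) * M"
  proof (rule entropyX_le[OF d])
    show "{1..n} \<subseteq> d ` ?T"
    proof
      fix l assume l: "l \<in> {1..n}"
      show "l \<in> d ` ?T"
      proof (cases "l = n")
        case True
        then show ?thesis
          using Suc.prems j by (intro image_eqI[of _ _ "Suc (n + i)"]) (auto simp: d_def tail_demand_def)
      next
        case False
        then show ?thesis
          using l j by (intro image_eqI[of _ _ l]) (auto simp: d_def tail_demand_def)
      qed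
    qed
  qed (use Suc.prems j in auto)
  moreover have "card ?T = n"
    using n by (subst card_Un_disjoint) auto
  moreover have "?S \<union> ?T = {1..n + Suc i}" "?S \<inter> ?T = {1..n - 1}"
    by auto
  \<comment> \<open>User \<open>K\<close> requests the last file, so its cache completes the
    library.\<close>
  moreover have "real N \<le> entropyX {1..n} {1..n - 1} d + M"
    using j by (intro entropyX_ge[OF d, of K]) (auto simp: d_def tail_demand_def N)
  ultimately show ?case
    using entropyX_submodular[of "{1..n}" ?S ?T d] Suc by (simp add: algebra_simps)
qed

text \<open>The swap does not touch users \<open>1\<close> to \<open>j\<close>. It hands the request
  of user \<open>K\<close>, the last file in the application, to user \<open>j + 1\<close> at equal
  entropy.\<close>

lemma entropyX_transpose:
  assumes N: "N = Suc n" and d: "d \<in> demands N K" and j: "Suc j \<le> K"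
  shows "entropyX {1..n} {1..j} (permute_demand (Transposition.transpose (Suc j) K) d) = entropyX {1..n} {1..j} d"
proof -
  have "Transposition.transpose (Suc j) K permutes {1..K}"
    using j by (intro permutes_swap_id) auto
  moreover have "Transposition.transpose (Suc j) K ` {1..j} = {1..j}"
    using j by (force simp: Transposition.transpose_def)
  ultimately show ?thesis
    using entropyX_permute[of "{1..n}" "{1..j}" d "Transposition.transpose (Suc j) K"] N d j by auto
qed

lemma cutset_sum_ge:
  assumes N: "N = Suc n" and n: "1 \<le> n" and K: "K = 2 * n + 1 + p"
  defines "G \<equiv> R + real n * M"
  shows "real K * real N - 1 \<le> real K * G + real p * real K / 2 * (G - real N + M)"
proof -
  define f where "f i = tail_demand n K (n + i) (\<lambda>k. k - i)" for i
  define g where "g j = tail_demand n K j (\<lambda>_. n)" for j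
  \<comment> \<open>For \<open>j < n\<close> the demand is that of the mirror index
    \<open>2 n - j\<close>, up to a swap making user \<open>j + 1\<close> request the last file.
    Thus \<open>\<beta> (n - i)\<close> and \<open>\<beta> (n + i)\<close> can be bounded together
    by \<open>entropyX_pair_le\<close>.\<close>
  define \<delta> where "\<delta> j = (if j < n then permute_demand (Transposition.transpose (Suc j) K) (f (n - j))
      else if j \<le> 2 * n then f (j - n) else g j)" for j
  define \<beta> where "\<beta> j = entropyX {1..n} {1..j} (\<delta> j)" for j
  have f: "f i \<in> demands N K" if "i \<le> n" for i
    unfolding f_def N using that K by (intro tail_demand_in_demands) auto
  have g: "g j \<in> demands N K" if "n \<le> j" "j < K" for j
    unfolding g_def N using that n by (intro tail_demand_in_demands) auto
  have \<delta>: "\<delta> j \<in> demands N K \<and> \<delta> j (Suc j) = N" if "j < K" for j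
  proof (cases "j < n")
    case True
    have "Transposition.transpose (Suc j) K permutes {1..K}"
      using that by (intro permutes_swap_id) auto
    then have "permute_demand (Transposition.transpose (Suc j) K) (f (n - j)) \<in> demands N K"
      by (intro permute_demand_in_demands f) auto
    then show ?thesis
      using True that K by (simp add: \<delta>_def permute_demand_def f_def tail_demand_def N)
  next
    case False
    then show ?thesis
      using that K f[of "j - n"] g[of j] by (auto simp: \<delta>_def f_def g_def tail_demand_def N)
  qed
  \<comment> \<open>The chain stops at \<open>K - 1\<close>; the term \<open>\<beta> (K - 1)\<close>
    then absorbs the remaining entropy of \<open>W_A\<close> and \<open>K - 1\<close>
    caches.\<close>
  have "real (K - 1) * real N + entropyZ {1..n} {1..0} \<le> entropyZ {1..n} {1..K - 1} + (\<Sum>j<K - 1. \<beta> j)"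
    unfolding \<beta>_def using \<delta>
    by (intro chain_sum_le[where c = "\<lambda>j. entropyZ {1..n} {1..j}"] entropyZ_decode_last[OF N]) auto
  also have "\<dots> \<le> (\<Sum>j<K. \<beta> j)"
    using entropyZ_le_entropyX[of "{1..n}" "{1..K - 1}" "\<delta> (K - 1)"] K by (simp add: \<beta>_def)
  \<comment> \<open>The chain starts from \<open>W_A\<close> alone, of entropy at least
    \<open>N - 1\<close>, and has \<open>K - 1\<close> links; hence \<open>K N - 1\<close>.\<close>
  finally have lower: "real K * real N - 1 \<le> (\<Sum>j<K. \<beta> j)"
    using entropyZ_ge[of N "{1..n}" "{1..0}"] N K by (simp add: atLeastAtMostSuc_conv algebra_simps)
  \<comment> \<open>The window around \<open>n\<close> grows by one mirror pair, of cost
    \<open>2 G\<close>, per step; at \<open>m = n\<close> it covers \<open>0\<close> to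
    \<open>2 n\<close>.\<close>
  have centre: "(\<Sum>j\<in>{n - m..n + m}. \<beta> j) \<le> (2 * real m + 1) * G" if "m \<le> n" for m
    using that
  proof (induction m)
    \<comment> \<open>For \<open>i = 0\<close> the pair bound counts the single term at
      \<open>n\<close> twice.\<close>
    case 0
    show ?case
      using entropyX_pair_le[OF N, of 0] K by (simp add: \<beta>_def \<delta>_def f_def G_def)
  next
    case (Suc m)
    have "{n - Suc m..n + Suc m} = insert (n - Suc m) (insert (n + Suc m) {n - m..n + m})"
      using Suc.prems by auto
    then have "(\<Sum>j\<in>{n - Suc m..n + Suc m}. \<beta> j) = \<beta> (n - Suc m) + \<beta> (n + Suc m) + (\<Sum>j\<in>{n - m..n + m}. \<beta> j)"
      using Suc.prems by (simp only:) (subst sum.insert; auto)+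
    moreover have "\<beta> (n - Suc m) + \<beta> (n + Suc m) \<le> 2 * G"
      using entropyX_pair_le[OF N, of "Suc m"] entropyX_transpose[OF N f, of "Suc m" "n - Suc m"] Suc.prems K
      by (simp add: \<beta>_def \<delta>_def f_def G_def)
    ultimately show ?case
      using Suc by (simp add: algebra_simps)
  qed
  \<comment> \<open>The term at \<open>j = 2 n + 1 + q\<close> is at most
    \<open>G + (n + 1 + q) (G - N + M)\<close>; summing the factors \<open>n + 1 + r\<close> over
    \<open>r < q\<close> gives \<open>q (q + 2 n + 1) / 2\<close>.\<close>
  have "(\<Sum>j<2 * n + 1 + q. \<beta> j)
      \<le> (2 * real n + 1 + real q) * G + real q * (real q + 2 * real n + 1) / 2 * (G - real N + M)" if "q \<le> p" for q
    using that
  proof (induction q)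
    case 0
    have "{..<2 * n + 1} = {n - n..n + n}"
      by auto
    then show ?case
      using centre[of n] by simp
  next
    case (Suc q)
    have "\<beta> (2 * n + 1 + q) + real (n + 1 + q) * (real N - M) \<le> (real (n + 1 + q) + 1) * G"
      using entropyX_extend_le[OF N n, of "2 * n + 1 + q" "n + 1 + q"] Suc.prems K
      by (simp add: \<beta>_def \<delta>_def g_def G_def mult_2 add.assoc)
    moreover have "(\<Sum>j<2 * n + 1 + Suc q. \<beta> j) = (\<Sum>j<2 * n + 1 + q. \<beta> j) + \<beta> (2 * n + 1 + q)"
      by simp
    ultimately show ?case
      using Suc by (simp add: field_simps)
  qed
  from order_trans[OF lower[unfolded K] this[of p]] show ?thesis
    by (simp add: K algebra_simps)
qed

end

theorem theorem2:
  fixes N K :: nat and M R :: real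
  assumes "1 \<le> N" and "int N < \<lceil>(real K + 1) / 2\<rceil>"
    and "achievable N K M R"
    and "1 / real K \<le> M" and "M \<le> real N / real K"
  shows "real K * (real N * (real K + 3) - 2 * ((real N)\<^sup>2 + 1)) / 2 * M
           + real K * (real K + 3 - 2 * real N) / 2 * R
         \<ge> (real N * real K * (real K - 2 * real N + 3) - 2) / 2"
proof -
  obtain F Z X where "symmetric_caching N K F M R Z X"
    using assms(3) by (auto simp: achievable_def symmetric_caching_def)
  then interpret symmetric_caching N K F M R Z X .
  have "real N < (real K + 1) / 2"
    using assms(2) by (simp add: less_ceiling_iff)
  then have K: "2 * N \<le> K"
    by simp
  show ?thesis
  proof (cases "N = 1")
    case True
    \<comment> \<open>With one file, all users request it, and \<open>M\<close> is forced to be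
      \<open>1 / K\<close>.\<close>
    define d where "d = (\<lambda>k\<in>{1..K}. 1 :: nat)"
    have d: "d \<in> demands N K"
      using K True by (auto simp: d_def demands_def image_constant_conv)
    have M: "real K * M = 1"
      using assms(4,5) K True by (simp add: field_simps)
    have "1 \<le> R + M"
      using entropyX_le[OF d, of "{}" "{}"] entropyX_ge[OF d, of 1 "{}" "{}"] K True by (simp add: d_def)
    \<comment> \<open>This is twice the claim: since \<open>K M = 1\<close>, replacing the
      coefficient \<open>K (K - 1)\<close> of \<open>M\<close> by \<open>K (K + 1)\<close> adds 2,
      which cancels the \<open>- 2\<close> on the right.\<close>
    then have "real K * (real K + 1) \<le> real K * (real K + 1) * (R + M)"
      using mult_left_mono[of 1 "R + M" "real K * (real K + 1)"] by simp
    moreover have "real K * (real K * M) = real K"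
      using M by simp
    ultimately show ?thesis
      using M True by (simp add: field_simps)
  next
    case False
    define n where "n = N - 1"
    \<comment> \<open>\<open>p\<close> counts the users beyond the central \<open>2 n + 1\<close>;
      \<open>2 N \<le> K\<close> makes the truncated subtraction exact.\<close>
    define p where "p = K - 2 * n - 1"
    have N: "N = Suc n" and n: "1 \<le> n" and K: "K = 2 * n + 1 + p"
      using False assms(1) K by (auto simp: n_def p_def)
    have rN: "real N = real n + 1" and rK: "real K = 2 * real n + 1 + real p"
      by (simp_all add: N K)
    \<comment> \<open>With \<open>p = K - 2 N + 1\<close>, the factor \<open>1 + p / 2\<close>
      becomes \<open>(K + 3 - 2 N) / 2\<close>.\<close>
    show ?thesis
      using cutset_sum_ge[OF N n K] unfolding rN rK by (simp add: field_simps power2_eq_square)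
  qed
qed

end
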